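(* Let $\Sigma$ be a finite alphabet with at least two letters. Then the language $AQ(\Sigma)\subseteq\Sigma^*$ of all A-primitive words over $\Sigma$ is not context-free.
   Context: For an ordered alphabet $\Sigma=\{a_1,\dots,a_m\}$ and $w\in\Sigma^*$, the Parikh vector of $w$ is $\Psi(w)=(|w|_{a_1},\dots,|w|_{a_m})$, where $|w|_{a}$ is the number of occurrences of the letter $a$ in $w$. A word $w$ is a $k$-th Abelian power if $w=u_1u_2\cdots u_k$ for some words $u_1,\dots,u_k$ with $\Psi(u_i)=\Psi(u_j)$ for all $1\le i,j\le k$. A word $w$ is A-primitive (Abelian primitive) if it is not a $k$-th Abelian power for any $k\ge 2$. $AQ(\Sigma)$ denotes the set of all A-primitive words in $\Sigma^*$. *)

theory Defs
  imports Main
begin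

datatype ('n, 't) sym = Nt 'n | Tm 't

type_synonym ('n, 't) prods = "('n \<times> ('n, 't) sym list) set"

definition derive1 :: "('n, 't) prods \<Rightarrow> ('n, 't) sym list \<Rightarrow> ('n, 't) sym list \<Rightarrow> bool" where
  "derive1 P u v \<longleftrightarrow>
     (\<exists>x y A \<alpha>. (A, \<alpha>) \<in> P \<and> u = x @ [Nt A] @ y \<and> v = x @ \<alpha> @ y)"

definition cfg_lang :: "('n, 't) prods \<Rightarrow> 'n \<Rightarrow> 't list set" where
  "cfg_lang P S = {w. (derive1 P)\<^sup>*\<^sup>* [Nt S] (map Tm w)}"

text \<open>A finite set of productions mentions only finitely many nonterminals and terminals,
  so no separate finiteness conditions are needed, and natural numbers can serve as names of the
  nonterminals without loss of generality. The productions may mention terminals that occur in no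
  word of the language, so the notion does not depend on an ambient alphabet.\<close>

definition context_free :: "'t list set \<Rightarrow> bool" where
  "context_free L \<longleftrightarrow> (\<exists>(P :: (nat, 't) prods) S. finite P \<and> L = cfg_lang P S)"

text \<open>The vector is indexed by the letters themselves instead of by their positions in an ordering
  of the alphabet. Entries for letters outside the alphabet of the word are zero, so comparing two
  vectors over the whole type is the same as comparing them over the alphabet.\<close>

definition parikh :: "'a list \<Rightarrow> 'a \<Rightarrow> nat" where
  "parikh w = (\<lambda>a. count_list w a)"

definition abelian_power :: "nat \<Rightarrow> 'a list \<Rightarrow> bool" where
  "abelian_power k w \<longleftrightarrow>
     (\<exists>us. length us = k \<and> w = concat us \<and>
           (\<forall>i<k. \<forall>j<k. parikh (us ! i) = parikh (us ! j)))"

text \<open>The empty word is a \<open>k\<close>-th Abelian power for every \<open>k\<close>, hence not A-primitive.\<close>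

definition A_primitive :: "'a list \<Rightarrow> bool" where
  "A_primitive w \<longleftrightarrow> (\<forall>k\<ge>2. \<not> abelian_power k w)"

definition AQ :: "'a set \<Rightarrow> 'a list set" where
  "AQ \<Sigma> = {w \<in> lists \<Sigma>. A_primitive w}"

end

theory Submission imports Defs Complex_Main begin

text \<open>Suppose a grammar generates the language, and consider the A-primitive word
  \<open>a\<^sup>n b\<^sup>n\<^sup>+\<^sup>g a\<^sup>n\<^sup>+\<^sup>g b\<^sup>n\<close> with \<open>g = 2 n!\<close>. A pumping inside its four blocks that lets the
  first block catch up with the third one, or the fourth with the second, ends in an Abelian
  square. Hence a pumping that enlarges the first block must enlarge the third one as well, so
  some nonterminal \<open>A\<close> spans the whole second block. Freezing \<open>A\<close> and pumping the last block in
  the derivation of the remaining word then leaves the second block unchanged, so the fourth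
  block catches up with it, unless the first block catches up with the third one before.\<close>

section \<open>Derivations\<close>

text \<open>Derivation forests in big-step form: the first list holds the roots, the second the
  leaves. By \<open>gen_keep\<close> a nonterminal may stay a leaf, so sentential forms like
  \<open>u @ [Nt A] @ y\<close> are covered, and induction follows the trees instead of the order of
  rewriting.\<close>

inductive gen :: "('n, 't) prods \<Rightarrow> ('n, 't) sym list \<Rightarrow> ('n, 't) sym list \<Rightarrow> bool" for P where
  gen_Nil: "gen P [] []"
| gen_keep: "gen P ss w \<Longrightarrow> gen P (X # ss) (X # w)"
| gen_expand: "(A, \<gamma>) \<in> P \<Longrightarrow> gen P \<gamma> v \<Longrightarrow> gen P ss w \<Longrightarrow> gen P (Nt A # ss) (v @ w)"

lemma gen_refl: "gen P ss ss"
  by (induction ss) (auto intro: gen.intros)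

lemma gen_append: "gen P s v \<Longrightarrow> gen P t w \<Longrightarrow> gen P (s @ t) (v @ w)"
  by (induction rule: gen.induct) (auto intro: gen.intros)

lemma gen_appendD: "gen P (s @ t) w \<Longrightarrow> \<exists>w1 w2. w = w1 @ w2 \<and> gen P s w1 \<and> gen P t w2"
proof (induction "s @ t" w arbitrary: s rule: gen.induct)
  case gen_Nil
  then show ?case by (auto intro: gen.intros)
next
  case (gen_keep ss w X)
  show ?case
  proof (cases s)
    case Nil
    then show ?thesis using gen_keep by (metis append_Nil gen.gen_Nil gen.gen_keep)
  next
    case (Cons Y s')
    then obtain w1 w2 where "w = w1 @ w2" "gen P s' w1" "gen P t w2"
      using gen_keep by force
    then have "X # w = (X # w1) @ w2" "gen P s (X # w1)" "gen P t w2"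
      using Cons gen_keep by (auto intro: gen.intros)
    then show ?thesis by blast
  qed
next
  case (gen_expand A \<gamma> v ss w)
  show ?case
  proof (cases s)
    case Nil
    then show ?thesis using gen_expand
      by (metis append_Nil gen.gen_Nil gen.gen_expand)
  next
    case (Cons Y s')
    then obtain w1 w2 where "w = w1 @ w2" "gen P s' w1" "gen P t w2"
      using gen_expand by force
    then have "v @ w = (v @ w1) @ w2" "gen P s (v @ w1)" "gen P t w2"
      using Cons gen_expand by (auto intro: gen.intros)
    then show ?thesis by blast
  qed
qed

lemma gen_rule: "(A, \<gamma>) \<in> P \<Longrightarrow> gen P \<gamma> w \<Longrightarrow> gen P [Nt A] w"
  using gen_expand[OF _ _ gen_Nil] by fastforce

lemma gen_NtD: "gen P [Nt A] w \<Longrightarrow> w = [Nt A] \<or> (\<exists>\<gamma>. (A, \<gamma>) \<in> P \<and> gen P \<gamma> w)"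
proof -
  have "v = []" if "gen P [] v" for v
    using that by (cases rule: gen.cases) auto
  note empty = this
  assume "gen P [Nt A] w"
  then show ?thesis
    by (cases rule: gen.cases) (auto dest: empty)
qed

lemma gen_trans: "gen P s t \<Longrightarrow> gen P t w \<Longrightarrow> gen P s w"
proof (induction arbitrary: w rule: gen.induct)
  case gen_Nil
  then show ?case .
next
  case (gen_keep ss v X)
  then obtain w1 w2 where "w = w1 @ w2" "gen P [X] w1" "gen P v w2"
    using gen_appendD[of P "[X]" v w] by auto
  then show ?case using gen_append[of P "[X]" w1 ss w2] gen_keep by auto
next
  case (gen_expand A \<gamma> v ss w')
  then obtain w1 w2 where "w = w1 @ w2" "gen P v w1" "gen P w' w2"
    using gen_appendD[of P v w' w] by auto
  then show ?case using gen_expand by (auto intro: gen.gen_expand)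
qed

lemma gen_context: "gen P s (u @ t @ y) \<Longrightarrow> gen P t w \<Longrightarrow> gen P s (u @ w @ y)"
  by (meson gen_append gen_refl gen_trans)

lemma derive1_append: "derive1 P u v \<Longrightarrow> derive1 P (x @ u @ y) (x @ v @ y)"
  unfolding derive1_def by (metis append.assoc)

lemma derives_append: "(derive1 P)\<^sup>*\<^sup>* u v \<Longrightarrow> (derive1 P)\<^sup>*\<^sup>* (x @ u @ y) (x @ v @ y)"
  by (induction rule: rtranclp_induct) (auto intro: derive1_append rtranclp.rtrancl_into_rtrancl)

lemma gen_imp_derives: "gen P s w \<Longrightarrow> (derive1 P)\<^sup>*\<^sup>* s w"
proof (induction rule: gen.induct)
  case gen_Nil
  then show ?case by simp
next
  case (gen_keep ss w X)
  then show ?case using derives_append[of P ss w "[X]" "[]"] by simp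
next
  case (gen_expand A \<gamma> v ss w)
  have "derive1 P (Nt A # ss) (\<gamma> @ ss)"
    unfolding derive1_def using gen_expand(1) by (metis append_Cons append_Nil)
  moreover have "(derive1 P)\<^sup>*\<^sup>* (\<gamma> @ ss) (v @ ss)"
    using derives_append[OF gen_expand(4), of "[]" ss] by simp
  moreover have "(derive1 P)\<^sup>*\<^sup>* (v @ ss) (v @ w)"
    using derives_append[OF gen_expand(5), of v "[]"] by simp
  ultimately show ?case by (meson converse_rtranclp_into_rtranclp rtranclp_trans)
qed

lemma derives_iff_gen: "(derive1 P)\<^sup>*\<^sup>* s w \<longleftrightarrow> gen P s w"
proof
  show "gen P s w" if "(derive1 P)\<^sup>*\<^sup>* s w"
    using that
  proof (induction rule: rtranclp_induct)
    case base
    then show ?case by (rule gen_refl)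
  next
    case (step v w)
    then obtain x y A \<alpha> where "(A, \<alpha>) \<in> P" "v = x @ [Nt A] @ y" "w = x @ \<alpha> @ y"
      unfolding derive1_def by blast
    then show ?case using step.IH gen_context gen_rule gen_refl by metis
  qed
qed (rule gen_imp_derives)

lemma gen_pump:
  assumes "gen P [Nt A] (v @ [Nt A] @ x)"
  shows "gen P [Nt A] (concat (replicate t v) @ [Nt A] @ concat (replicate t x))"
proof (induction t)
  case 0
  then show ?case by (simp add: gen_refl)
next
  case (Suc t)
  have "concat (replicate (Suc t) x) = concat (replicate t x) @ x"
    by (simp flip: replicate_append_same)
  then show ?case using gen_context[OF assms Suc] by simp
qed

text \<open>This unfreezes a nonterminal: after \<open>A\<close> has been carried along like a
  letter, all its occurrences receive the same yield \<open>m\<close>.\<close>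

lemma gen_substitute:
  assumes "gen P [Nt A] m"
  shows "gen P s (concat (map (\<lambda>X. if X = Nt A then m else [X]) s))"
proof (induction s)
  case Nil
  then show ?case by (simp add: gen_Nil)
next
  case (Cons X s)
  have "gen P [X] (if X = Nt A then m else [X])"
    using assms by (auto intro: gen_refl)
  from gen_append[OF this Cons] show ?case by simp
qed

section \<open>Pumping marked positions\<close>

text \<open>The offset \<open>k\<close> is the position at which \<open>w\<close> starts in the
  whole word, so \<open>M\<close> can stay a fixed set of absolute positions.\<close>

definition marks :: "nat set \<Rightarrow> nat \<Rightarrow> 'a list \<Rightarrow> nat" where
  "marks M k w = card (M \<inter> {k..<k + length w})"

lemma marks_Nil [simp]: "marks M k [] = 0"
  by (simp add: marks_def)

lemma marks_append: "marks M k (v @ w) = marks M k v + marks M (k + length v) w"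
proof -
  have "M \<inter> {k..<k + length (v @ w)} =
      (M \<inter> {k..<k + length v}) \<union> (M \<inter> {k + length v..<k + length v + length w})"
    by auto
  then show ?thesis
    unfolding marks_def by (simp add: card_Un_disjoint disjoint_iff)
qed

lemma marks_le_length: "marks M k w \<le> length w"
proof -
  have "card (M \<inter> {k..<k + length w}) \<le> card {k..<k + length w}"
    by (rule card_mono) auto
  then show ?thesis by (simp add: marks_def)
qed

lemma marks_Cons_split: "marks M k (X # w) = marks M k [X] + marks M (Suc k) w"
  using marks_append[of M k "[X]" w] by simp

text \<open>Pigeonhole over the \<open>length ss\<close> trees of the forest. A lone leaf carries at
  most one mark, so \<open>K \<ge> 1\<close> makes the heavy tree one whose root is
  expanded.\<close>

lemma heavy_child:
  assumes "gen P ss w" "marks M k w > K * length ss" "K \<ge> 1"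
  shows "\<exists>u B \<gamma> z y. w = u @ z @ y \<and> gen P ss (u @ [Nt B] @ y) \<and> (B, \<gamma>) \<in> P \<and> gen P \<gamma> z \<and>
           marks M (k + length u) z > K"
  using assms
proof (induction arbitrary: k rule: gen.induct)
  case gen_Nil
  then show ?case by simp
next
  case (gen_keep ss w X)
  have "marks M k [X] \<le> K"
    using marks_le_length[of M k "[X]"] gen_keep(4) by simp
  then have "marks M (Suc k) w > K * length ss"
    using gen_keep(3) marks_Cons_split[of M k X w] by simp
  then obtain u B \<gamma> z y where *: "w = u @ z @ y" "gen P ss (u @ [Nt B] @ y)" "(B, \<gamma>) \<in> P"
      "gen P \<gamma> z" "marks M (Suc k + length u) z > K"
    using gen_keep by blast
  show ?case
    by (rule exI[of _ "X # u"], rule exI[of _ B], rule exI[of _ \<gamma>], rule exI[of _ z],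
        rule exI[of _ y]) (use * in \<open>auto intro: gen.gen_keep\<close>)
next
  case (gen_expand A \<gamma> v ss w)
  show ?case
  proof (cases "marks M k v > K")
    case True
    show ?thesis
      by (rule exI[of _ "[]"], rule exI[of _ A], rule exI[of _ \<gamma>], rule exI[of _ v],
          rule exI[of _ w]) (use gen_expand True in \<open>auto intro: gen.gen_keep\<close>)
  next
    case False
    then have h: "marks M (k + length v) w > K * length ss"
      using gen_expand(6) by (simp add: marks_append)
    obtain u B \<gamma>' z y where *: "w = u @ z @ y" "gen P ss (u @ [Nt B] @ y)" "(B, \<gamma>') \<in> P"
        "gen P \<gamma>' z" "marks M (k + length v + length u) z > K"
      using gen_expand.IH(2)[OF h gen_expand(7)] by blast
    show ?thesis
      by (rule exI[of _ "v @ u"], rule exI[of _ B], rule exI[of _ \<gamma>'], rule exI[of _ z],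
          rule exI[of _ y])
        (use * gen.gen_expand[OF gen_expand(1,2) *(2)] in \<open>simp add: add.assoc\<close>)
  qed
qed

text \<open>The tree found by pigeonhole may carry all marks. Then the proof descends into the
  right-hand side of its root rule, which has at most \<open>d\<close> symbols, until the marks are
  no longer all in one tree.\<close>

lemma heavy_proper_descendant:
  assumes "gen P ss w" "marks M k w > K * length ss" "K \<ge> 1"
    and "marks M k w > K * d" "\<forall>(A, \<gamma>) \<in> P. length \<gamma> \<le> d"
  shows "\<exists>u B \<gamma> z y. w = u @ z @ y \<and> gen P ss (u @ [Nt B] @ y) \<and> (B, \<gamma>) \<in> P \<and> gen P \<gamma> z \<and>
           marks M (k + length u) z > K \<and> marks M (k + length u) z < marks M k w"
  using assms
proof (induction arbitrary: k rule: gen.induct)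
  case gen_Nil
  then show ?case by simp
next
  case (gen_keep ss w X)
  have m: "marks M k [X] \<le> 1"
    using marks_le_length[of M k "[X]"] by simp
  have e: "marks M k (X # w) = marks M k [X] + marks M (Suc k) w"
    by (rule marks_Cons_split)
  have h: "marks M (Suc k) w > K * length ss"
    using gen_keep(3,4) e m by simp
  have "\<exists>u B \<gamma> z y. w = u @ z @ y \<and> gen P ss (u @ [Nt B] @ y) \<and> (B, \<gamma>) \<in> P \<and> gen P \<gamma> z \<and>
           marks M (Suc k + length u) z > K \<and> marks M (Suc k + length u) z < marks M k (X # w)"
  \<comment> \<open>A mark on \<open>X\<close> is lost on passing to the rest, so
    \<open>heavy_child\<close> already gives the strict drop; otherwise the rest carries all marks
    and the induction hypothesis applies.\<close>
  proof (cases "marks M k [X] = 0")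
    case True
    then show ?thesis using gen_keep.IH[OF h gen_keep(4)] gen_keep(5,6) e by simp
  next
    case False
    obtain u B \<gamma> z y where *: "w = u @ z @ y" "gen P ss (u @ [Nt B] @ y)" "(B, \<gamma>) \<in> P"
        "gen P \<gamma> z" "marks M (Suc k + length u) z > K"
      using heavy_child[OF gen_keep(1) h gen_keep(4)] by blast
    moreover have "marks M (Suc k + length u) z < marks M k (X # w)"
      using e False *(1) by (simp add: marks_append)
    ultimately show ?thesis by blast
  qed
  then obtain u B \<gamma> z y where *: "w = u @ z @ y" "gen P ss (u @ [Nt B] @ y)" "(B, \<gamma>) \<in> P"
      "gen P \<gamma> z" "marks M (Suc k + length u) z > K"
      "marks M (Suc k + length u) z < marks M k (X # w)" by blast
  show ?case
    by (rule exI[of _ "X # u"], rule exI[of _ B], rule exI[of _ \<gamma>], rule exI[of _ z],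
        rule exI[of _ y]) (use * in \<open>auto intro: gen.gen_keep\<close>)
next
  case (gen_expand A \<gamma> v ss w)
  have e: "marks M k (v @ w) = marks M k v + marks M (k + length v) w"
    by (rule marks_append)
  \<comment> \<open>\<open>all\<close>: descend into the first tree; \<open>heavy\<close>: take that
    tree itself; \<open>light\<close>: the other trees still exceed the pigeonhole bound.\<close>
  consider (all) "marks M k v = marks M k (v @ w)"
    | (heavy) "K < marks M k v" "marks M k v < marks M k (v @ w)"
    | (light) "marks M k v \<le> K"
    using e by linarith
  then show ?case
  proof cases
    case all
    have "K * length \<gamma> \<le> K * d"
      by (rule mult_le_mono2) (use gen_expand(1,9) in auto)
    then have "marks M k v > K * length \<gamma>"
      using gen_expand(8) all by linarith
    then obtain u B \<gamma>' z y where *: "v = u @ z @ y" "gen P \<gamma> (u @ [Nt B] @ y)" "(B, \<gamma>') \<in> P"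
        "gen P \<gamma>' z" "marks M (k + length u) z > K" "marks M (k + length u) z < marks M k v"
      using gen_expand.IH(1)[of k] gen_expand(7-9) all by auto
    show ?thesis
      by (rule exI[of _ u], rule exI[of _ B], rule exI[of _ \<gamma>'], rule exI[of _ z],
          rule exI[of _ "y @ w"])
        (use * all gen_expand gen.gen_expand[OF gen_expand(1) *(2) gen_expand(3)] in auto)
  next
    case heavy
    show ?thesis
      by (rule exI[of _ "[]"], rule exI[of _ A], rule exI[of _ \<gamma>], rule exI[of _ v],
          rule exI[of _ w]) (use gen_expand heavy in \<open>auto intro: gen.gen_keep\<close>)
  next
    case light
    then have h: "marks M (k + length v) w > K * length ss"
      using gen_expand(6) e by simp
    have "\<exists>u B \<gamma> z y. w = u @ z @ y \<and> gen P ss (u @ [Nt B] @ y) \<and> (B, \<gamma>) \<in> P \<and> gen P \<gamma> z \<and>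
           marks M (k + length v + length u) z > K \<and>
           marks M (k + length v + length u) z < marks M k (v @ w)"
    proof (cases "marks M k v = 0")
      case True
      then show ?thesis using gen_expand.IH(2)[OF h gen_expand(7)] gen_expand(8,9) e by simp
    next
      case False
      obtain u B \<gamma> z y where *: "w = u @ z @ y" "gen P ss (u @ [Nt B] @ y)" "(B, \<gamma>) \<in> P"
          "gen P \<gamma> z" "marks M (k + length v + length u) z > K"
        using heavy_child[OF gen_expand(3) h gen_expand(7)] by blast
      moreover have "marks M (k + length v + length u) z < marks M k (v @ w)"
        using e False *(1) by (simp add: marks_append)
      ultimately show ?thesis by blast
    qed
    then obtain u B \<gamma>' z y where *: "w = u @ z @ y" "gen P ss (u @ [Nt B] @ y)" "(B, \<gamma>') \<in> P"
        "gen P \<gamma>' z" "marks M (k + length v + length u) z > K"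
        "marks M (k + length v + length u) z < marks M k (v @ w)" by blast
    show ?thesis
      by (rule exI[of _ "v @ u"], rule exI[of _ B], rule exI[of _ \<gamma>'], rule exI[of _ z],
          rule exI[of _ y])
        (use * gen.gen_expand[OF gen_expand(1,2) *(2)] in \<open>simp add: add.assoc\<close>)
  qed
qed

text \<open>A node of a derivation tree is given by the yield to its left, its nonterminal, its own
  yield and the yield to its right.\<close>

type_synonym ('n, 't) node =
  "('n, 't) sym list \<times> 'n \<times> ('n, 't) sym list \<times> ('n, 't) sym list"

definition expanded :: "('n, 't) prods \<Rightarrow> ('n, 't) node \<Rightarrow> bool" where
  "expanded P = (\<lambda>(u, B, w, y). \<exists>\<gamma>. (B, \<gamma>) \<in> P \<and> gen P \<gamma> w)"

text \<open>The strict drop says that \<open>v\<close> or \<open>x\<close> carries a mark. It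
  survives composition, so the relation holds between any two nodes of a chain.\<close>

definition below :: "('n, 't) prods \<Rightarrow> nat set \<Rightarrow> ('n, 't) node \<Rightarrow> ('n, 't) node \<Rightarrow> bool" where
  "below P M = (\<lambda>(u, B, w, y) (u', B', w', y').
     \<exists>v x. u' = u @ v \<and> y' = x @ y \<and> w = v @ w' @ x \<and> gen P [Nt B] (v @ [Nt B'] @ x) \<and>
           marks M (length u') w' < marks M (length u) w)"

lemma below_trans:
  assumes "below P M N1 N2" "below P M N2 N3"
  shows "below P M N1 N3"
proof -
  obtain u B w y where 1: "N1 = (u, B, w, y)" by (cases N1) auto
  obtain u2 B2 w2 y2 where 2: "N2 = (u2, B2, w2, y2)" by (cases N2) auto
  obtain u3 B3 w3 y3 where 3: "N3 = (u3, B3, w3, y3)" by (cases N3) auto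
  obtain v x where a: "u2 = u @ v" "y2 = x @ y" "w = v @ w2 @ x"
      "gen P [Nt B] (v @ [Nt B2] @ x)" "marks M (length u2) w2 < marks M (length u) w"
    using assms(1) unfolding below_def 1 2 by auto
  obtain v' x' where b: "u3 = u2 @ v'" "y3 = x' @ y2" "w2 = v' @ w3 @ x'"
      "gen P [Nt B2] (v' @ [Nt B3] @ x')" "marks M (length u3) w3 < marks M (length u2) w2"
    using assms(2) unfolding below_def 2 3 by auto
  have "gen P [Nt B] ((v @ v') @ [Nt B3] @ (x' @ x))"
    using gen_context[OF a(4) b(4)] by simp
  moreover have "u3 = u @ (v @ v')" "y3 = (x' @ x) @ y" "w = (v @ v') @ w3 @ (x' @ x)"
    "marks M (length u3) w3 < marks M (length u) w"
    using a b by auto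
  ultimately show ?thesis unfolding below_def 1 3 by blast
qed

text \<open>Each descent by \<open>heavy_proper_descendant\<close> lowers the guaranteed number of
  marks from above \<open>d ^ Suc n\<close> to above \<open>d ^ n\<close>.\<close>

lemma marked_chain:
  assumes "expanded P N" "N = (u, B, w, y)" "marks M (length u) w > d ^ n" "d \<ge> 1"
    and "\<forall>(A, \<gamma>) \<in> P. length \<gamma> \<le> d"
  shows "\<exists>Ns. length Ns = n \<and> sorted_wrt (below P M) (N # Ns) \<and> (\<forall>N' \<in> set Ns. expanded P N')"
  using assms(1-3)
proof (induction n arbitrary: N u B w y)
  case 0
  then show ?case by simp
next
  case (Suc n)
  obtain \<gamma> where g: "(B, \<gamma>) \<in> P" "gen P \<gamma> w"
    using Suc.prems unfolding expanded_def by auto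
  have m: "marks M (length u) w > d ^ n * d"
    using Suc.prems(3) by (simp add: mult.commute)
  have "d ^ n * length \<gamma> \<le> d ^ n * d"
    by (rule mult_le_mono2) (use assms(5) g(1) in auto)
  then have m': "marks M (length u) w > d ^ n * length \<gamma>"
    using m by linarith
  obtain v B' \<gamma>' z x where *: "w = v @ z @ x" "gen P \<gamma> (v @ [Nt B'] @ x)" "(B', \<gamma>') \<in> P"
      "gen P \<gamma>' z" "marks M (length u + length v) z > d ^ n"
      "marks M (length u + length v) z < marks M (length u) w"
    using heavy_proper_descendant[OF g(2) m' one_le_power[OF assms(4)] m assms(5)] by blast
  define N' where "N' = (u @ v, B', z, x @ y)"
  have b: "below P M N N'"
    using * gen_rule[OF g(1) *(2)] unfolding below_def N'_def Suc.prems(2) by auto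
  have ex: "expanded P N'"
    unfolding expanded_def N'_def using * by auto
  obtain Ns where Ns: "length Ns = n" "sorted_wrt (below P M) (N' # Ns)"
      "\<forall>N' \<in> set Ns. expanded P N'"
    using Suc.IH[OF ex N'_def] * by auto
  have "sorted_wrt (below P M) (N # N' # Ns)"
    using Ns(2) b by (auto intro: below_trans)
  then show ?case using Ns ex by (intro exI[of _ "N' # Ns"]) auto
qed

text \<open>\<open>c\<close> colours cuts, given as prefix lengths, rather than letters. For a
  monotone colouring, equal colours at both ends put all cuts of \<open>v\<close>, and likewise of
  \<open>x\<close>, into one class.\<close>

definition pump_factors :: "('n, 't) prods \<Rightarrow> 'n \<Rightarrow> nat set \<Rightarrow> (nat \<Rightarrow> nat) \<Rightarrow> ('n, 't) sym list \<Rightarrow>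
    'n \<Rightarrow> ('n, 't) sym list \<Rightarrow> ('n, 't) sym list \<Rightarrow> ('n, 't) sym list \<Rightarrow> ('n, 't) sym list \<Rightarrow>
    ('n, 't) sym list \<Rightarrow> bool" where
  "pump_factors P S M c w A u v z x y \<longleftrightarrow>
     w = u @ v @ z @ x @ y \<and> gen P [Nt S] (u @ [Nt A] @ y) \<and>
     gen P [Nt A] (v @ [Nt A] @ x) \<and> gen P [Nt A] z \<and>
     c (length (u @ v)) = c (length u) \<and>
     c (length (u @ v @ z @ x)) = c (length (u @ v @ z)) \<and>
     (\<exists>p \<in> M. length u \<le> p \<and> p < length (u @ v) \<or>
              length (u @ v @ z) \<le> p \<and> p < length (u @ v @ z @ x))"

text \<open>A variant of Ogden's lemma without a bound on the length of the pumped part. The colouring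
  of the positions, which forces each pumped factor into a single block, replaces the
  intersection with a regular language.\<close>

lemma pumping:
  fixes P :: "('n, 't) prods"
  assumes "finite P"
  obtains N where "\<And>S w M (c :: nat \<Rightarrow> nat).
      gen P [Nt S] w \<Longrightarrow> marks M 0 w > N \<Longrightarrow> (\<And>p. c p < C) \<Longrightarrow>
      \<exists>A u v z x y. pump_factors P S M c w A u v z x y"
proof -
  obtain d where d: "d \<ge> 1" "\<forall>(A, \<gamma>) \<in> P. length \<gamma> \<le> d"
  proof
    show "Max (insert 1 ((length \<circ> snd) ` P)) \<ge> 1"
      using assms by simp
    show "\<forall>(A, \<gamma>) \<in> P. length \<gamma> \<le> Max (insert 1 ((length \<circ> snd) ` P))"
      using assms by (auto intro!: Max_ge simp: image_iff Bex_def split: prod.splits) force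
  qed
  \<comment> \<open>Labels consist of a nonterminal and the colours at both ends of its yield. A
    chain of \<open>card F\<close> nodes below the root has one node more than there are labels, so
    two nodes agree.\<close>
  define F where "F = fst ` P \<times> {..<C} \<times> {..<C}"
  have fin: "finite F" unfolding F_def using assms by simp
  show thesis
  proof (rule that[of "d ^ card F"])
    fix S w M and c :: "nat \<Rightarrow> nat"
    assume w: "gen P [Nt S] w" and m: "marks M 0 w > d ^ card F" and c: "\<And>p. c p < C"
    \<comment> \<open>Two symbols rule out \<open>w = [Nt S]\<close>, so the root is
      expanded.\<close>
    have "length w \<ge> 2"
      using m marks_le_length[of M 0 w] one_le_power[OF d(1), of "card F"] by linarith
    then have "\<exists>\<gamma>. (S, \<gamma>) \<in> P \<and> gen P \<gamma> w"
      using gen_NtD[OF w] by auto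
    then have "expanded P ([], S, w, [])"
      unfolding expanded_def by auto
    then obtain Ns where Ns: "length Ns = card F"
        "sorted_wrt (below P M) (([], S, w, []) # Ns)"
        "\<forall>N' \<in> set (([], S, w, []) # Ns). expanded P N'"
      using marked_chain[OF _ refl, of P "[]" S w "[]" d "card F" M] d m by auto
    define Ms where "Ms = ([], S, w, []) # Ns"
    define lab where "lab = (\<lambda>(u :: ('n, 't) sym list, B :: 'n, w :: ('n, 't) sym list,
      y :: ('n, 't) sym list). (B, c (length u), c (length (u @ w))))"
    have "lab ` set Ms \<subseteq> F"
      using Ns(3) c unfolding Ms_def[symmetric] lab_def F_def expanded_def by force
    then have "card (set (map lab Ms)) \<le> card F"
      using fin by (simp add: card_mono)
    then have "\<not> distinct (map lab Ms)"
      using Ns(1) distinct_card[of "map lab Ms"] unfolding Ms_def by fastforce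
    then obtain i' j' where "i' < length Ms" "j' < length Ms" "i' \<noteq> j'"
        "lab (Ms ! i') = lab (Ms ! j')"
      unfolding distinct_conv_nth by auto
    then obtain i j where ij: "i < j" "j < length Ms" "lab (Ms ! i) = lab (Ms ! j)"
      by (metis linorder_neqE_nat)
    have bij: "below P M (Ms ! i) (Ms ! j)"
      using Ns(2) ij sorted_wrt_nth_less unfolding Ms_def[symmetric] by blast
    have b0: "Ms ! i = ([], S, w, []) \<or> below P M ([], S, w, []) (Ms ! i)"
      using Ns(2) ij unfolding Ms_def by (cases i) auto
    obtain u A w1 y where n1: "Ms ! i = (u, A, w1, y)" by (cases "Ms ! i") auto
    obtain u2 A2 z y2 where n2: "Ms ! j = (u2, A2, z, y2)" by (cases "Ms ! j") auto
    obtain v x where *: "u2 = u @ v" "y2 = x @ y" "w1 = v @ z @ x"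
        "gen P [Nt A] (v @ [Nt A2] @ x)" "marks M (length u2) z < marks M (length u) w1"
      using bij unfolding n1 n2 below_def by auto
    have same: "A2 = A" "c (length u) = c (length (u @ v))"
        "c (length (u @ v @ z)) = c (length (u @ v @ z @ x))"
      using ij(3) * unfolding n1 n2 lab_def by (auto simp: add.assoc)
    have top: "w = u @ w1 @ y" "gen P [Nt S] (u @ [Nt A] @ y)"
      using b0 unfolding n1 below_def by (auto simp: gen_refl)
    have "expanded P (Ms ! j)"
      using Ns(3) ij(2) nth_mem unfolding Ms_def by metis
    then have z: "gen P [Nt A] z"
      unfolding n2 expanded_def using same(1) gen_rule by auto
    have "marks M (length u) v > 0 \<or> marks M (length (u @ v @ z)) x > 0"
      using *(5) unfolding *(1,3) by (auto simp: marks_append add.assoc)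
    then have "\<exists>p \<in> M. length u \<le> p \<and> p < length (u @ v) \<or>
                 length (u @ v @ z) \<le> p \<and> p < length (u @ v @ z @ x)"
      unfolding marks_def by (fastforce simp: card_gt_0_iff)
    with same top * z have "pump_factors P S M c w A u v z x y"
      unfolding pump_factors_def by simp
    then show "\<exists>A u v z x y. pump_factors P S M c w A u v z x y"
      by blast
  qed
qed

section \<open>Words with four blocks\<close>

definition blocks :: "'a \<Rightarrow> 'a \<Rightarrow> (nat \<Rightarrow> nat) \<Rightarrow> 'a list" where
  "blocks a b e = replicate (e 0) a @ replicate (e 1) b @ replicate (e 2) a @ replicate (e 3) b"

text \<open>A cut on a boundary counts to the block on its right; two cuts of equal value thus
  enclose letters of one block only.\<close>

definition block_at :: "(nat \<Rightarrow> nat) \<Rightarrow> nat \<Rightarrow> nat" where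
  "block_at e p = (if p < e 0 then 0 else if p < e 0 + e 1 then 1
     else if p < e 0 + e 1 + e 2 then 2 else 3)"

lemma block_at_less: "block_at e p < 4"
  by (simp add: block_at_def)

lemma block_at_mono: "p \<le> q \<Longrightarrow> block_at e p \<le> block_at e q"
  by (simp add: block_at_def)

lemma length_blocks: "length (blocks a b e) = e 0 + e 1 + e 2 + e 3"
  by (simp add: blocks_def)

lemma map_blocks: "map f (blocks a b e) = blocks (f a) (f b) e"
  by (simp add: blocks_def)

lemma pump_replicate:
  assumes "l @ replicate m s @ r = u @ v @ z" "length l \<le> length u"
    "length (u @ v) \<le> length l + m"
  shows "u @ concat (replicate t v) @ v @ z = l @ replicate (m + t * length v) s @ r"
proof -
  define u' where "u' = drop (length l) u"
  have "take (length l) u = l"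
    using arg_cong[OF assms(1), of "take (length l)"] assms(2) by simp
  then have u: "u = l @ u'"
    unfolding u'_def by (metis append_take_drop_id)
  have u': "replicate m s @ r = u' @ v @ z"
    using assms(1) unfolding u by simp
  have len: "length (u' @ v) \<le> m" using assms(3) u by simp
  define z' where "z' = take (m - length (u' @ v)) z"
  have z1: "replicate m s = (u' @ v) @ z'"
    using arg_cong[OF u', of "take m"] len unfolding z'_def by simp
  have z2: "z = z' @ r"
    using u' unfolding z1 by simp
  have "set u' \<subseteq> {s}" "set v \<subseteq> {s}" "set z' \<subseteq> {s}"
    using arg_cong[OF z1, of set] by (auto split: if_splits)
  then have "u' = replicate (length u') s" "v = replicate (length v) s" "z' = replicate (length z') s"
    by (metis replicate_eqI singletonD subsetD)+
  moreover have "m = length u' + length v + length z'"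
    using arg_cong[OF z1, of length] by simp
  moreover have "concat (replicate t (replicate k s)) = replicate (t * k) s" for k
    by (induction t) (auto simp: replicate_add)
  ultimately obtain i j k where "u' = replicate i s" "v = replicate j s" "z' = replicate k s"
      "m = i + j + k"  "concat (replicate t v) = replicate (t * j) s"
    by metis
  then show ?thesis
    using u z2 by (simp flip: replicate_add add: add_ac)
qed

lemma pump_block:
  assumes "blocks a b e = u @ v @ z" "block_at e (length u) = r" "block_at e (length (u @ v)) = r"
  shows "u @ concat (replicate t v) @ v @ z = blocks a b (e(r := e r + t * length v))"
proof -
  have l: "length u + length v \<le> e 0 + e 1 + e 2 + e 3"
    using arg_cong[OF assms(1), of length] by (simp add: length_blocks)
  consider "r = 0" "length u + length v \<le> e 0"
    | "r = 1" "e 0 \<le> length u" "length u + length v \<le> e 0 + e 1"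
    | "r = 2" "e 0 + e 1 \<le> length u" "length u + length v \<le> e 0 + e 1 + e 2"
    | "r = 3" "e 0 + e 1 + e 2 \<le> length u"
    using assms(2,3) by (auto simp: block_at_def split: if_splits)
  then show ?thesis
  proof cases
    case 1
    show ?thesis
      using pump_replicate[of "[]" "e 0" a "replicate (e 1) b @ replicate (e 2) a @ replicate (e 3) b"
          u v z t] assms(1) 1 by (simp add: blocks_def)
  next
    case 2
    show ?thesis
      using pump_replicate[of "replicate (e 0) a" "e 1" b "replicate (e 2) a @ replicate (e 3) b"
          u v z t] assms(1) 2 by (simp add: blocks_def)
  next
    case 3
    show ?thesis
      using pump_replicate[of "replicate (e 0) a @ replicate (e 1) b" "e 2" a "replicate (e 3) b"
          u v z t] assms(1) 3 by (simp add: blocks_def)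
  next
    case 4
    show ?thesis
      using pump_replicate[of "replicate (e 0) a @ replicate (e 1) b @ replicate (e 2) a" "e 3" b "[]"
          u v z t] assms(1) 4 l by (simp add: blocks_def)
  qed
qed

text \<open>A sum, because both pumped factors may lie in the same block and then both lengthen
  it.\<close>

definition increment :: "nat \<Rightarrow> nat \<Rightarrow> nat \<Rightarrow> nat \<Rightarrow> nat \<Rightarrow> nat" where
  "increment r m s n i = (if i = r then m else 0) + (if i = s then n else 0)"

text \<open>The two bounds hold because \<open>v\<close> and \<open>x\<close> are disjoint factors,
  so their letters in an outer block fit into it. They later bound the growth by \<open>n\<close>,
  where divisors of \<open>fact n\<close> are wanted.\<close>

lemma pump_two_blocks:
  assumes "blocks a b e = u @ v @ z @ x @ y"
    "block_at e (length u) = r" "block_at e (length (u @ v)) = r"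
    "block_at e (length (u @ v @ z)) = s" "block_at e (length (u @ v @ z @ x)) = s"
  shows "u @ (concat (replicate t v) @ v) @ z @ (concat (replicate t x) @ x) @ y =
           blocks a b (\<lambda>i. e i + t * increment r (length v) s (length x) i)"
    and "increment r (length v) s (length x) 0 \<le> e 0"
    and "increment r (length v) s (length x) 3 \<le> e 3"
proof -
  have rs: "r \<le> s"
    using assms(3,4) block_at_mono[of "length (u @ v)" "length (u @ v @ z)" e] by simp
  have l: "length u + length v + length z + length x \<le> e 0 + e 1 + e 2 + e 3"
    using arg_cong[OF assms(1), of length] by (simp add: length_blocks)
  \<comment> \<open>The right factor is pumped first: as \<open>r \<le> s\<close>, this moves no cut
    out of block \<open>r\<close>.\<close>
  define e' where "e' = e(s := e s + t * length x)"
  have 1: "blocks a b e' = u @ v @ (z @ (concat (replicate t x) @ x) @ y)"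
    using pump_block[of a b e "u @ v @ z" x y s t] assms unfolding e'_def by simp
  have r: "r < 4" "s < 4" using assms(2,4) block_at_less by blast+
  have bl: "block_at e' p = r" if "block_at e p = r" for p
    using that rs r unfolding block_at_def e'_def by (auto split: if_splits)
  have "u @ concat (replicate t v) @ v @ (z @ (concat (replicate t x) @ x) @ y) =
      blocks a b (e'(r := e' r + t * length v))"
    by (rule pump_block[OF 1 bl bl]) (use assms in auto)
  moreover have "e'(r := e' r + t * length v) =
      (\<lambda>i. e i + t * increment r (length v) s (length x) i)"
    unfolding e'_def increment_def by (auto simp: fun_eq_iff algebra_simps)
  ultimately show "u @ (concat (replicate t v) @ v) @ z @ (concat (replicate t x) @ x) @ y =
           blocks a b (\<lambda>i. e i + t * increment r (length v) s (length x) i)"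
    by simp
  show "increment r (length v) s (length x) 0 \<le> e 0"
    using assms(2-5) l unfolding increment_def block_at_def by (auto split: if_splits)
  show "increment r (length v) s (length x) 3 \<le> e 3"
    using assms(2-5) l unfolding increment_def block_at_def by (auto split: if_splits)
qed

section \<open>Abelian squares among the words with four blocks\<close>

lemma count_list_replicate_if: "count_list (replicate n x) y = (if x = y then n else 0)"
  by (induction n) auto

lemma abelian_square_append:
  assumes "parikh u = parikh v"
  shows "\<not> A_primitive (u @ v)"
proof -
  have "abelian_power 2 (u @ v)"
    unfolding abelian_power_def using assms
    by (intro exI[of _ "[u, v]"]) (auto simp: less_Suc_eq numeral_2_eq_2)
  then show ?thesis unfolding A_primitive_def by blast
qed

text \<open>With \<open>h\<close> half the difference of the b-exponents, the cut \<open>h\<close>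
  letters before the end of the second block halves both counts.\<close>

lemma abelian_square_equal_a:
  assumes "a \<noteq> b" "e 0 = e 2" "e 3 \<le> e 1" "even (e 1 + e 3)"
  shows "\<not> A_primitive (blocks a b e)"
proof -
  obtain h where h: "e 1 = e 3 + 2 * h"
    using assms(3,4) by (metis even_diff_nat dvd_def le_add_diff_inverse add.commute)
  have "blocks a b e = (replicate (e 0) a @ replicate (e 3 + h) b) @
      (replicate h b @ replicate (e 2) a @ replicate (e 3) b)"
    unfolding blocks_def h by (simp add: replicate_add[symmetric] append_assoc[symmetric] mult_2 del: append_assoc)
       (simp add: append_assoc replicate_add)
  moreover have "parikh (replicate (e 0) a @ replicate (e 3 + h) b) =
      parikh (replicate h b @ replicate (e 2) a @ replicate (e 3) b)"
    unfolding parikh_def using assms by (auto simp: count_list_replicate_if)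
  ultimately show ?thesis using abelian_square_append by metis
qed

text \<open>Here the cut lies \<open>h\<close> letters into the third block, \<open>h\<close> being
  half the difference of the a-exponents.\<close>

lemma abelian_square_equal_b:
  assumes "a \<noteq> b" "e 1 = e 3" "e 0 \<le> e 2" "even (e 0 + e 2)"
  shows "\<not> A_primitive (blocks a b e)"
proof -
  obtain h where h: "e 2 = e 0 + 2 * h"
    using assms(3,4) by (metis even_diff_nat dvd_def le_add_diff_inverse add.commute)
  have "blocks a b e = (replicate (e 0) a @ replicate (e 1) b @ replicate h a) @
      (replicate (e 0 + h) a @ replicate (e 3) b)"
    unfolding blocks_def h by (metis mult_2 add.assoc add.commute append_assoc replicate_add)
  moreover have "parikh (replicate (e 0) a @ replicate (e 1) b @ replicate h a) =
      parikh (replicate (e 0 + h) a @ replicate (e 3) b)"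
    unfolding parikh_def using assms by (auto simp: count_list_replicate_if)
  ultimately show ?thesis using abelian_square_append by metis
qed

definition exponents :: "nat \<Rightarrow> nat \<Rightarrow> nat \<Rightarrow> nat" where
  "exponents n g i = (if i = 0 \<or> i = 3 then n else n + g)"

text \<open>The difference of the exponents of the two blocks of a's (or of b's) is twice a factorial,
  so it can be closed in an even number of pumping steps; doing so for the pair of blocks that
  closes first yields an Abelian square.\<close>

lemma pumped_not_A_primitive:
  assumes "a \<noteq> b" "f 0 \<le> n" "f 3 \<le> n" "f 2 < f 0 \<or> f 1 < f 3"
  shows "\<exists>t. \<not> A_primitive (blocks a b (\<lambda>i. exponents n (2 * fact n) i + t * f i))"
proof -
  \<comment> \<open>The larger of the rates at which the two gaps close. It lies between 1 and
    \<open>n\<close>, hence divides \<open>fact n\<close>.\<close>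
  define k where "k = max (int (f 0) - int (f 2)) (int (f 3) - int (f 1))"
  have k: "1 \<le> nat k" "nat k \<le> n" "int (nat k) = k"
    using assms unfolding k_def by auto
  obtain q where q: "fact n = nat k * q"
    using dvd_fact[OF k(1,2)] by (auto simp: dvd_def)
  \<comment> \<open>After \<open>2 * q\<close> steps the faster gap is exactly 0 and the other is
    nonnegative; the even number of steps keeps the sums in \<open>ev\<close> even.\<close>
  define E where "E = (\<lambda>i. exponents n (2 * fact n) i + (2 * q) * f i)"
  have g: "2 * int q * k = 2 * int (fact n)"
    unfolding q using k(3) by (simp add: ac_simps)
  have E: "E 0 = n + 2 * (q * f 0)" "E 1 = n + 2 * fact n + 2 * (q * f 1)"
      "E 2 = n + 2 * fact n + 2 * (q * f 2)" "E 3 = n + 2 * (q * f 3)"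
    unfolding E_def exponents_def by auto
  have ev: "even (E 1 + E 3)" "even (E 0 + E 2)"
    unfolding E by auto
  have d1: "int (E 2) - int (E 0) = 2 * int q * (k - (int (f 0) - int (f 2)))"
    unfolding right_diff_distrib g by (simp add: E algebra_simps del: One_nat_def)
  have d2: "int (E 1) - int (E 3) = 2 * int q * (k - (int (f 3) - int (f 1)))"
    unfolding right_diff_distrib g by (simp add: E algebra_simps del: One_nat_def)
  have "int (E 2) - int (E 0) \<ge> 0" "int (E 1) - int (E 3) \<ge> 0"
    unfolding d1 d2 k_def by (intro mult_nonneg_nonneg; simp)+
  moreover have "int (E 2) - int (E 0) = 0 \<or> int (E 1) - int (E 3) = 0"
    unfolding d1 d2 k_def by auto
  ultimately have "\<not> A_primitive (blocks a b E)"
    using abelian_square_equal_a[of a b E, OF assms(1)] abelian_square_equal_b[of a b E, OF assms(1)] ev by auto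
  then show ?thesis unfolding E_def by blast
qed

text \<open>Along the word the surplus of a's over b's runs through 0, \<open>n\<close>,
  \<open>-g\<close>, \<open>n\<close>, 0 at the block ends and is linear in between, so its zeros
  can be read off.\<close>

lemma balanced_prefix_blocks:
  assumes "a \<noteq> b" "blocks a b (exponents n g) = p @ s" "count_list p a = count_list p b"
  shows "length p \<in> {0, 2 * n, 2 * n + 2 * g, 4 * n + 2 * g}"
proof -
  have p: "p = take (length p) (blocks a b (exponents n g))"
    using assms(2) by simp
  have l: "length p \<le> 4 * n + 2 * g"
    using arg_cong[OF assms(2), of length] by (simp add: length_blocks exponents_def)
  define m where "m = length p"
  have c: "count_list p c = count_list (take m (blocks a b (exponents n g))) c" for c
    using p m_def by simp
  \<comment> \<open>The a's on the left, the b's on the right, block by block; truncated subtraction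
    yields 0 for a block not yet reached.\<close>
  have "min m n + min (m - (2 * n + g)) (n + g) =
      min (m - n) (n + g) + min (m - (3 * n + 2 * g)) n"
    using assms(1,3) unfolding c
    by (simp add: blocks_def exponents_def  count_list_replicate_if
        min.commute add_ac numeral_3_eq_3 mult_2)
  then show ?thesis
    using l unfolding m_def[symmetric] by (auto simp: min_def split: if_splits)
qed

lemma length_eq_counts:
  assumes "a \<noteq> b" "set w \<subseteq> {a, b}"
  shows "length w = count_list w a + count_list w b"
  using assms(2) by (induction w) (use assms(1) in auto)

lemma count_list_concat_const:
  assumes "\<And>u. u \<in> set us \<Longrightarrow> count_list u x = q"
  shows "count_list (concat us) x = length us * q"
  using assms by (induction us) (auto simp: count_list_append)

lemma set_blocks: "set (blocks a b e) \<subseteq> {a, b}"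
  by (auto simp: blocks_def)

text \<open>The word has equally many a's and b's, hence so has each factor of an Abelian power. The
  prefixes of one and of two factors are then balanced, of lengths L and 2L with L > 0; for
  \<open>0 < n\<close> and \<open>n < g\<close> no two balanced prefixes have such lengths.\<close>

lemma A_primitive_blocks:
  assumes "a \<noteq> b" "0 < n" "n < g"
  shows "A_primitive (blocks a b (exponents n g))"
  unfolding A_primitive_def
proof (intro allI impI notI)
  fix k assume k: "2 \<le> k" and "abelian_power k (blocks a b (exponents n g))"
  then obtain us where us: "length us = k" "blocks a b (exponents n g) = concat us"
      "\<And>i j. i < k \<Longrightarrow> j < k \<Longrightarrow> parikh (us ! i) = parikh (us ! j)"
    unfolding abelian_power_def by auto
  obtain u1 u2 rest where u: "us = u1 # u2 # rest"
    using us(1) k by (metis Suc_le_length_iff numeral_2_eq_2)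
  have same: "count_list v c = count_list u1 c" if v: "v \<in> set us" for v c
  proof -
    obtain i where i: "i < k" "us ! i = v"
      using v unfolding in_set_conv_nth us(1) by blast
    have "parikh v = parikh u1"
      using us(3)[of i 0] i k u by simp
    then show ?thesis unfolding parikh_def by (rule fun_cong)
  qed
  have tot: "count_list (blocks a b (exponents n g)) c = k * count_list u1 c" for c
    unfolding us(2) us(1)[symmetric] by (rule count_list_concat_const) (rule same)
  have ab: "k * count_list u1 a = 2 * n + g" "k * count_list u1 b = 2 * n + g"
    using assms(1) unfolding tot[symmetric]
    by (simp_all add: blocks_def exponents_def count_list_replicate_if)
  then have "k * count_list u1 a = k * count_list u1 b"
    by (rule trans[OF _ sym])
  then have eq: "count_list u1 a = count_list u1 b"
    using k by simp
  have pos: "count_list u1 a > 0"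
    using ab(1) assms(2) by (cases "count_list u1 a") auto
  have u2: "count_list u2 c = count_list u1 c" for c
    by (rule same) (simp add: u)
  have "set (concat us) \<subseteq> {a, b}"
    unfolding us(2)[symmetric] by (rule set_blocks)
  then have sub: "set u1 \<subseteq> {a, b}" "set u2 \<subseteq> {a, b}"
    unfolding u by simp_all
  have len: "length u1 = 2 * count_list u1 a" "length u2 = 2 * count_list u1 a"
    using length_eq_counts[OF assms(1)] sub eq u2 by auto
  have 1: "length u1 \<in> {0, 2 * n, 2 * n + 2 * g, 4 * n + 2 * g}"
    using balanced_prefix_blocks[OF assms(1), of n g u1 "concat (u2 # rest)"] us(2) u eq by simp
  have 2: "length (u1 @ u2) \<in> {0, 2 * n, 2 * n + 2 * g, 4 * n + 2 * g}"
    using balanced_prefix_blocks[OF assms(1), of n g "u1 @ u2" "concat rest"] us(2) u eq u2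
    by (simp add: count_list_append)
  show False using 1 2 len pos assms(2,3) by auto
qed

section \<open>The language of A-primitive words\<close>

lemma gen_pump_context:
  assumes "gen P [Nt S] (u @ [Nt A] @ y)" "gen P [Nt A] (v @ [Nt A] @ x)" "gen P [Nt A] z"
  shows "gen P [Nt S] (u @ (concat (replicate t v) @ v) @ z @ (concat (replicate t x) @ x) @ y)"
proof -
  have rep: "concat (replicate (Suc t) w) = concat (replicate t w) @ w" for w :: "('n, 't) sym list"
    by (simp flip: replicate_append_same)
  have "gen P [Nt A] (concat (replicate (Suc t) v) @ z @ concat (replicate (Suc t) x))"
    using gen_context[OF gen_pump[OF assms(2)] assms(3)] .
  from gen_context[OF assms(1) this] show ?thesis unfolding rep by simp
qed

text \<open>If all pumped words are generated, none is an Abelian square, so by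
  \<open>pumped_not_A_primitive\<close> neither gap may shrink.\<close>

lemma not_pumpable:
  assumes "a \<noteq> b" "cfg_lang P S \<subseteq> Collect A_primitive" "f 0 \<le> n" "f 3 \<le> n"
    and "\<And>t. gen P [Nt S] (blocks (Tm a) (Tm b) (\<lambda>i. exponents n (2 * fact n) i + t * f i))"
  shows "f 0 \<le> f 2" "f 3 \<le> f 1"
proof -
  have "A_primitive (blocks a b (\<lambda>i. exponents n (2 * fact n) i + t * f i))" for t
    using assms(2) assms(5)[of t]
    unfolding cfg_lang_def derives_iff_gen map_blocks[of Tm, symmetric] by auto
  then show "f 0 \<le> f 2" "f 3 \<le> f 1"
    using pumped_not_A_primitive[OF assms(1), of f n] assms(3,4) by (meson not_less)+
qed

theorem theorem1:
  fixes \<Sigma> :: "'a set"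
  assumes "finite \<Sigma>"
    and "card \<Sigma> \<ge> 2"
  shows "\<not> context_free (AQ \<Sigma>)"
proof
  assume "context_free (AQ \<Sigma>)"
  then obtain P :: "(nat, 'a) prods" and S where P: "finite P" "AQ \<Sigma> = cfg_lang P S"
    unfolding context_free_def by blast
  obtain a b where ab: "a \<in> \<Sigma>" "b \<in> \<Sigma>" "a \<noteq> b"
    using assms card_le_Suc0_iff_eq[OF assms(1)] by force
  obtain N where N: "\<And>S w M (c :: nat \<Rightarrow> nat).
      gen P [Nt S] w \<Longrightarrow> marks M 0 w > N \<Longrightarrow> (\<And>p. c p < 4) \<Longrightarrow>
      \<exists>A u v z x y. pump_factors P S M c w A u v z x y"
    using pumping[OF P(1)] by metis
  \<comment> \<open>One more than the pumping bound, so that marking one outer block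
    suffices.\<close>
  define n where "n = Suc N"
  define e where "e = exponents n (2 * fact n)"
  define W where "W = (blocks (Tm a) (Tm b) e :: (nat, 'a) sym list)"
  have e: "e 0 = n" "e 1 = n + 2 * fact n" "e 2 = n + 2 * fact n" "e 3 = n"
    unfolding e_def exponents_def by auto
  have lenW: "length W = e 0 + e 1 + e 2 + n"
    unfolding W_def length_blocks e(4) by simp
  have sub: "cfg_lang P S \<subseteq> Collect A_primitive"
    unfolding P(2)[symmetric] AQ_def by blast
  have "n < 2 * fact n"
    using fact_ge_self[of n] fact_gt_zero[of n, where 'a = nat] by linarith
  then have "A_primitive (blocks a b e)"
    unfolding e_def by (intro A_primitive_blocks ab) (simp_all add: n_def)
  moreover have "blocks a b e \<in> lists \<Sigma>"
    using set_blocks[of a b e] ab by auto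
  ultimately have "blocks a b e \<in> cfg_lang P S"
    unfolding P(2)[symmetric] AQ_def by blast
  then have gW: "gen P [Nt S] W"
    unfolding cfg_lang_def derives_iff_gen W_def map_blocks[of Tm a b e, symmetric] by simp

  \<comment> \<open>Pumping with the first block marked\<close>
  have "{..<n} \<inter> {0..<0 + length W} = {..<n}"
    unfolding lenW by auto
  then have "marks {..<n} 0 W > N"
    unfolding marks_def by (simp add: n_def)
  from N[OF gW this, of "block_at e", OF block_at_less]
  obtain A u v z x y where "pump_factors P S {..<n} (block_at e) W A u v z x y"
    by blast
  then have W: "W = u @ v @ z @ x @ y"
    and g: "gen P [Nt S] (u @ [Nt A] @ y)" "gen P [Nt A] (v @ [Nt A] @ x)" "gen P [Nt A] z"
    and bv: "block_at e (length (u @ v)) = block_at e (length u)"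
    and bx: "block_at e (length (u @ v @ z @ x)) = block_at e (length (u @ v @ z))"
    and mark: "\<exists>p\<in>{..<n}. length u \<le> p \<and> p < length (u @ v) \<or>
                 length (u @ v @ z) \<le> p \<and> p < length (u @ v @ z @ x)"
    unfolding pump_factors_def by blast+
  define r where "r = block_at e (length u)"
  define s where "s = block_at e (length (u @ v @ z))"
  define f where "f = increment r (length v) s (length x)"
  note pump = pump_two_blocks[OF W[unfolded W_def] r_def[symmetric] bv[folded r_def]
      s_def[symmetric] bx[folded s_def], folded f_def]
  have "f 0 \<le> f 2"
  proof (rule not_pumpable(1)[OF ab(3) sub])
    show "f 0 \<le> n" "f 3 \<le> n" using pump(2,3) e by auto
    show "gen P [Nt S] (blocks (Tm a) (Tm b) (\<lambda>i. exponents n (2 * fact n) i + t * f i))" for t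
      using gen_pump_context[OF g] unfolding e_def[symmetric] pump(1)[symmetric] by blast
  qed
  moreover have "r = 0"
  proof -
    have "length u < n" using mark by auto
    then show ?thesis unfolding r_def block_at_def e by simp
  qed
  moreover have "f 0 > 0"
  proof (cases "length v = 0")
    case True
    with mark have "length (u @ v @ z) < n" "length x > 0" by auto
    then have "s = 0" unfolding s_def block_at_def e by simp
    then show ?thesis using \<open>length x > 0\<close> unfolding f_def increment_def by simp
  next
    case False
    then show ?thesis using \<open>r = 0\<close> unfolding f_def increment_def by simp
  qed
  \<comment> \<open>The first block grows, so the third must grow too; as \<open>v\<close> lies in
    the first, \<open>x\<close> lies in the third.\<close>
  ultimately have "s = 2"
    unfolding f_def increment_def by (auto split: if_splits)
  \<comment> \<open>Hence the yield of \<open>A\<close> starts inside the first block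
    (\<open>lu\<close>) and ends inside the third (\<open>lx\<close>), covering the second.\<close>
  have lu: "length u < n"
    using \<open>r = 0\<close> unfolding r_def block_at_def e by (simp split: if_splits)
  have lx: "e 0 + e 1 \<le> length (u @ v @ z @ x)" "length (u @ v @ z @ x) < e 0 + e 1 + e 2"
    using \<open>s = 2\<close> bx unfolding s_def[symmetric] by (auto simp: block_at_def split: if_splits)

  \<comment> \<open>Freezing the nonterminal that spans the second block\<close>
  define m where "m = v @ z @ x"
  have gm: "gen P [Nt A] m"
    unfolding m_def by (rule gen_context[OF g(2,3)])
  have Wm: "W = u @ m @ y" unfolding W m_def by simp
  have lm: "e 0 + e 1 \<le> length u + length m" "length u + length m < e 0 + e 1 + e 2"
    using lx unfolding m_def by simp_all
  then have ly: "n < length y"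
    using arg_cong[OF Wm, of length] unfolding lenW by simp
  \<comment> \<open>\<open>A\<close> is treated like a terminal of \<open>W'\<close>; \<open>h\<close> puts its yield \<open>m\<close> back, and \<open>pos\<close> maps positions of \<open>W'\<close> to positions of \<open>W\<close>.\<close>
  define W' where "W' = u @ [Nt A] @ y"
  have lW: "length W = length W' - 1 + length m" "length W' = Suc (length u + length y)"
    unfolding Wm W'_def by simp_all
  define h where "h = (\<lambda>t. concat (map (\<lambda>X. if X = Nt A then m else [X]) t))"
  have h_append: "h (t @ t') = h t @ h t'" for t t' unfolding h_def by simp
  have h_id: "h t = t" if "Nt A \<notin> set t" for t
    using that unfolding h_def by (induction t) auto
  have "set W \<subseteq> {Tm a, Tm b}" unfolding W_def by (rule set_blocks)
  then have A: "Nt A \<notin> set u" "Nt A \<notin> set y" unfolding Wm by auto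
  have hW: "h W' = W"
    unfolding W'_def Wm h_append h_id[OF A(1)] h_id[OF A(2)] by (simp add: h_def)
  define pos where "pos = (\<lambda>p. if p \<le> length u then p else p - 1 + length m)"
  have len_h: "length (h t) = pos (length t)" if "W' = t @ t'" for t t'
  proof -
    have "u @ Nt A # y = t @ t'" using that unfolding W'_def by simp
    then consider us where "u = t @ us" | us where "t = u @ Nt A # us" "y = us @ t'"
      by (auto simp: append_eq_append_conv2 append_eq_Cons_conv Cons_eq_append_conv)
    then show ?thesis
    proof cases
      case 1
      then have "Nt A \<notin> set t" using A by simp
      then show ?thesis using 1 h_id unfolding pos_def by simp
    next
      case 2
      then have "h us = us" using A by (intro h_id) auto
      then have "h t = u @ m @ us"
        using h_append[of u "Nt A # us"] h_append[of "[Nt A]" us] h_id[OF A(1)] 2(1)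
        by (simp add: h_def)
      then show ?thesis using 2(1) unfolding pos_def by simp
    qed
  qed
  \<comment> \<open>\<open>A\<close> is one symbol of \<open>W'\<close>, so no cut falls inside its
    yield; hence no pumping of \<open>W'\<close> can be located in the second block.\<close>
  have block_pos: "1 \<noteq> block_at e (pos p)" for p
    using lu lm unfolding pos_def block_at_def e by auto
  \<comment> \<open>A factor containing \<open>A\<close> starts in the first block and ends beyond
    the second, so its ends differ in colour.\<close>
  have A_notin: "Nt A \<notin> set t"
    if W': "W' = t1 @ t @ t2" and eq: "block_at e (pos (length (t1 @ t))) = block_at e (pos (length t1))"
    for t1 t t2
  proof
    assume "Nt A \<in> set t"
    then obtain v1 v2 where t: "t = v1 @ Nt A # v2" by (auto simp: in_set_conv_decomp)
    have "u @ Nt A # y = (t1 @ v1) @ Nt A # (v2 @ t2)"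
      using W' unfolding W'_def t by simp
    then have "u = t1 @ v1"
      using A append_Cons_eq_iff[of "Nt A" u y] by blast
    then have "length t1 \<le> length u" "length u < length (t1 @ t)"
      unfolding t by simp_all
    then show False
      using eq lu lm unfolding pos_def block_at_def e by (auto split: if_splits)
  qed

  \<comment> \<open>Pumping with the last block marked\<close>
  have "{length W' - n..<length W'} \<inter> {0..<0 + length W'} = {length W' - n..<length W'}"
    by auto
  then have "marks {length W' - n..<length W'} 0 W' > N"
    unfolding marks_def using ly lW(2) by (simp add: n_def)
  from N[OF g(1)[folded W'_def] this, of "\<lambda>p. block_at e (pos p)", OF block_at_less]
  obtain B u' v' z' x' y' where
    "pump_factors P S {length W' - n..<length W'} (\<lambda>p. block_at e (pos p)) W' B u' v' z' x' y'"
    by blast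
  then have W': "W' = u' @ v' @ z' @ x' @ y'"
    and g': "gen P [Nt S] (u' @ [Nt B] @ y')" "gen P [Nt B] (v' @ [Nt B] @ x')" "gen P [Nt B] z'"
    and bv': "block_at e (pos (length (u' @ v'))) = block_at e (pos (length u'))"
    and bx': "block_at e (pos (length (u' @ v' @ z' @ x'))) =
      block_at e (pos (length (u' @ v' @ z')))"
    and mark': "\<exists>p\<in>{length W' - n..<length W'}. length u' \<le> p \<and> p < length (u' @ v') \<or>
                 length (u' @ v' @ z') \<le> p \<and> p < length (u' @ v' @ z' @ x')"
    unfolding pump_factors_def by blast+
  have Av: "Nt A \<notin> set v'"
    using A_notin[OF _ bv', of "z' @ x' @ y'"] W' by simp
  have Ax: "Nt A \<notin> set x'"
    using A_notin[of "u' @ v' @ z'" x' y'] W' bx' by simp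
  have hu: "length (h u') = pos (length u')" "length (h u' @ v') = pos (length (u' @ v'))"
      "length (h u' @ v' @ h z') = pos (length (u' @ v' @ z'))"
      "length (h u' @ v' @ h z' @ x') = pos (length (u' @ v' @ z' @ x'))"
    using len_h[of u' "v' @ z' @ x' @ y'"] len_h[of "u' @ v'" "z' @ x' @ y'"]
      len_h[of "u' @ v' @ z'" "x' @ y'"] len_h[of "u' @ v' @ z' @ x'" y'] W'
    by (simp_all add: h_append h_id Av Ax)
  \<comment> \<open>As \<open>A\<close> is absent from \<open>v'\<close> and \<open>x'\<close>,
    \<open>h\<close> fixes both, and pumping commutes with putting \<open>m\<close> back.\<close>
  have Wh: "blocks (Tm a) (Tm b) e = h u' @ v' @ h z' @ x' @ h y'"
    using hW unfolding W' W_def h_append h_id[OF Av] h_id[OF Ax] by simp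
  define r' where "r' = block_at e (pos (length u'))"
  define s' where "s' = block_at e (pos (length (u' @ v' @ z')))"
  define f' where "f' = increment r' (length v') s' (length x')"
  have "block_at e (length (h u')) = r'" "block_at e (length (h u' @ v')) = r'"
      "block_at e (length (h u' @ v' @ h z')) = s'"
      "block_at e (length (h u' @ v' @ h z' @ x')) = s'"
    unfolding hu r'_def s'_def using bv' bx' by simp_all
  note pump' = pump_two_blocks[OF Wh this, folded f'_def]
  have "f' 3 \<le> f' 1"
  proof (rule not_pumpable(2)[OF ab(3) sub])
    show "f' 0 \<le> n" "f' 3 \<le> n" using pump'(2,3) e by auto
    fix t
    let ?v = "concat (replicate t v') @ v'" and ?x = "concat (replicate t x') @ x'"
    have "gen P [Nt S] (h (u' @ ?v @ z' @ ?x @ y'))"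
      using gen_trans[OF gen_pump_context[OF g'] gen_substitute[OF gm]] unfolding h_def .
    moreover have "h ?v = ?v" "h ?x = ?x"
      using Av Ax by (intro h_id; auto)+
    ultimately have "gen P [Nt S] (h u' @ ?v @ h z' @ ?x @ h y')"
      unfolding h_append[of u'] h_append[of ?v] h_append[of z'] h_append[of ?x] by simp
    then show "gen P [Nt S] (blocks (Tm a) (Tm b) (\<lambda>i. exponents n (2 * fact n) i + t * f' i))"
      unfolding e_def[symmetric] pump'(1) .
  qed
  moreover have "f' 1 = 0"
    unfolding f'_def increment_def r'_def s'_def by (simp only: block_pos if_False add_0)
  moreover have "f' 3 > 0"
  proof -
    \<comment> \<open>Applied to right ends: a factor with a marked letter ends strictly after the
      first marked position, and its left end has the same colour.\<close>
    have late: "block_at e (pos p) = 3" if "p > length W' - n" for p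
    proof -
      have "p > length u" using that lW(2) ly by simp
      then have "pos p \<ge> e 0 + e 1 + e 2"
        using that lW ly lenW unfolding pos_def by simp
      then show ?thesis unfolding block_at_def by simp
    qed
    from mark' consider "length (u' @ v') > length W' - n" "length v' > 0"
      | "length (u' @ v' @ z' @ x') > length W' - n" "length x' > 0"
      by fastforce
    then show ?thesis
    proof cases
      case 1
      then have "r' = 3" unfolding r'_def bv'[symmetric] by (intro late)
      then show ?thesis using 1 unfolding f'_def increment_def by simp
    next
      case 2
      then have "s' = 3" unfolding s'_def bx'[symmetric] by (intro late)
      then show ?thesis using 2 unfolding f'_def increment_def by simp
    qed
  qed
  ultimately show False by simp
qed

end
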